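(* Let $\mathbb F$ be a field of characteristic not equal to $2$, let $l,r\ge1$ be integers, let $\mathcal U$ be a vector space over $\mathbb F$ with $\dim_{\mathbb F}\mathcal U=n$, let $b:\mathcal U\times\mathcal U\to\mathbb F$ be a nondegenerate symmetric bilinear form, and let $0\ne u\in\mathcal U$. Then $E_{lr}(\mathcal U,b,u)$ is a nilpotent evolution algebra of type $[\underbrace{1,1,\dots,1}_{r},n,\underbrace{1,1,\dots,1}_{l}]$.
   Context: Here $n$ is a natural number (finite dimension). An algebra over a field is not assumed associative or unital. An evolution algebra over a field is an algebra admitting a basis $\{e_i\}$ (a natural basis) such that $e_ie_j=0$ whenever $i\ne j$ (each $e_i^2$ being an arbitrary linear combination of basis elements). For an evolution algebra $E$ put $E^1=E$ and $E^m=\sum_{i=1}^{m-1}E^iE^{m-i}$ for $m\ge2$; $E$ is nilpotent if $E^m=0$ for some $m\in\mathbb N$. For an algebra $\mathcal A$ define $\operatorname{ann}^0(\mathcal A)=0$, $\operatorname{ann}^1(\mathcal A)=\operatorname{ann}(\mathcal A)=\{x\in\mathcal A: x\mathcal A=\mathcal A x=0\}$, and $\operatorname{ann}^i(\mathcal A)$ by $\operatorname{ann}^i(\mathcal A)/\operatorname{ann}^{i-1}(\mathcal A)=\operatorname{ann}(\mathcal A/\operatorname{ann}^{i-1}(\mathcal A))$. If $\mathcal A$ is finite-dimensional and nilpotent and $s$ is the lowest natural number with $\operatorname{ann}^s(\mathcal A)=\mathcal A$, the type of $\mathcal A$ is the sequence $[n_1,\dots,n_s]$ with $n_i=\dim_{\mathbb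 F}\operatorname{ann}^i(\mathcal A)-\dim_{\mathbb F}\operatorname{ann}^{i-1}(\mathcal A)$. The algebra $E_{lr}(\mathcal U,b,u)$ is the vector space $\underbrace{\mathbb F\times\dots\times\mathbb F}_l\times\mathcal U\times\underbrace{\mathbb F\times\dots\times\mathbb F}_r$ with multiplication $$(\alpha_1,\dots,\alpha_l,x,\beta_1,\dots,\beta_r)(\gamma_1,\dots,\gamma_l,y,\delta_1,\dots,\delta_r)=(0,\alpha_1\gamma_1,\alpha_2\gamma_2,\dots,\alpha_{l-1}\gamma_{l-1},\,\alpha_l\gamma_l u,\,b(x,y),\,\beta_1\delta_1,\dots,\beta_{r-1}\delta_{r-1})$$ for $x,y\in\mathcal U$ and $\alpha_i,\beta_j,\gamma_i,\delta_j\in\mathbb F$. *)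

theory Defs
  imports
    "HOL-Computational_Algebra.Computational_Algebra"
    "HOL-Library.Function_Algebras"
    "HOL-Library.Product_Plus"
    "HOL-Library.Set_Algebras"
begin

definition annihilator :: "'q set \<Rightarrow> ('q \<Rightarrow> 'q \<Rightarrow> 'q) \<Rightarrow> 'q \<Rightarrow> 'q set" where
  "annihilator Q m z = {x \<in> Q. \<forall>y\<in>Q. m x y = z \<and> m y x = z}"

text \<open>
  The underlying vector space of the algebra is the subspace \<open>A\<close> of an ambient
  vector space, so that its dimension may depend on natural-number parameters.
  Neither associativity nor a unit is assumed.
\<close>

locale nonassoc_algebra = vector_space scale
  for scale :: "'f::field \<Rightarrow> 'v::ab_group_add \<Rightarrow> 'v" +
  fixes A :: "'v set"
    and mult :: "'v \<Rightarrow> 'v \<Rightarrow> 'v" (infixl \<open>\<bullet>\<close> 70)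
  assumes subspace_A: "subspace A"
    and mult_closed: "\<lbrakk>x \<in> A; y \<in> A\<rbrakk> \<Longrightarrow> x \<bullet> y \<in> A"
    and mult_add_left: "\<lbrakk>x \<in> A; y \<in> A; z \<in> A\<rbrakk> \<Longrightarrow> (x + y) \<bullet> z = x \<bullet> z + y \<bullet> z"
    and mult_add_right: "\<lbrakk>x \<in> A; y \<in> A; z \<in> A\<rbrakk> \<Longrightarrow> x \<bullet> (y + z) = x \<bullet> y + x \<bullet> z"
    and mult_scale_left: "\<lbrakk>x \<in> A; y \<in> A\<rbrakk> \<Longrightarrow> scale c x \<bullet> y = scale c (x \<bullet> y)"
    and mult_scale_right: "\<lbrakk>x \<in> A; y \<in> A\<rbrakk> \<Longrightarrow> x \<bullet> scale c y = scale c (x \<bullet> y)"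
begin

definition subspace_prod :: "'v set \<Rightarrow> 'v set \<Rightarrow> 'v set" where
  "subspace_prod S T = span {x \<bullet> y | x y. x \<in> S \<and> y \<in> T}"

text \<open>The sum over \<open>i\<close> is the elementwise sum of subsets of \<open>'v\<close>.
  The value at \<open>0\<close> is a dummy, which is why \<open>nilpotent\<close> requires a positive exponent.\<close>

function alg_power :: "nat \<Rightarrow> 'v set" where
  "alg_power m =
     (if m \<le> 1 then A
      else \<Sum>i\<in>{1..<m}. subspace_prod (alg_power i) (alg_power (m - i)))"
  by pat_completeness auto
termination by (relation "measure id") auto
declare alg_power.simps [simp del]

definition nilpotent :: bool where
  "nilpotent \<longleftrightarrow> (\<exists>m\<ge>1. alg_power m = {0})"

definition natural_basis :: "'v set \<Rightarrow> bool" where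
  "natural_basis B \<longleftrightarrow>
     independent B \<and> span B = A \<and> (\<forall>e\<in>B. \<forall>f\<in>B. e \<noteq> f \<longrightarrow> e \<bullet> f = 0)"

definition finite_dimensional :: bool where
  "finite_dimensional \<longleftrightarrow> (\<exists>B. finite B \<and> span B = A)"

text \<open>The quotient \<open>A / I\<close> as a set of cosets; its zero element is the coset \<open>I\<close>.
  If \<open>I\<close> is an ideal, the union in \<open>quot_mult\<close> is the single coset of \<open>x \<bullet> y\<close>
  (see \<open>quot_mult_coset\<close>).\<close>

definition quot :: "'v set \<Rightarrow> 'v set set" where
  "quot I = (\<lambda>x. x +o I) ` A"

definition quot_mult :: "'v set \<Rightarrow> 'v set \<Rightarrow> 'v set \<Rightarrow> 'v set" where
  "quot_mult I X Y = (\<Union>x\<in>X. \<Union>y\<in>Y. (x \<bullet> y) +o I)"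

primrec ann_series :: "nat \<Rightarrow> 'v set" where
  "ann_series 0 = {0}"
| "ann_series (Suc i) =
     {x \<in> A. x +o ann_series i \<in>
        annihilator (quot (ann_series i)) (quot_mult (ann_series i)) (ann_series i)}"

definition has_type :: "nat list \<Rightarrow> bool" where
  "has_type ns \<longleftrightarrow> finite_dimensional \<and> nilpotent \<and>
     (\<exists>s. ann_series s = A \<and> (\<forall>t<s. ann_series t \<noteq> A) \<and>
        ns = map (\<lambda>i. dim (ann_series i) - dim (ann_series (i - 1))) [1..<Suc s])"

definition is_ideal :: "'v set \<Rightarrow> bool" where
  "is_ideal I \<longleftrightarrow> subspace I \<and> I \<subseteq> A \<and>
     (\<forall>x\<in>A. \<forall>y\<in>I. x \<bullet> y \<in> I \<and> y \<bullet> x \<in> I)"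

lemma coset_eq_self_iff:
  assumes "subspace I"
  shows "x +o I = I \<longleftrightarrow> x \<in> I"
proof
  assume "x +o I = I"
  moreover have "x + 0 \<in> x +o I"
    using subspace_0[OF assms] by (rule set_plus_intro2)
  ultimately show "x \<in> I" by simp
next
  assume x: "x \<in> I"
  show "x +o I = I"
  proof
    show "x +o I \<subseteq> I"
      using x subspace_add[OF assms] by (auto simp: elt_set_plus_def)
    show "I \<subseteq> x +o I"
    proof
      fix y assume "y \<in> I"
      then have "y - x \<in> I" "y = x + (y - x)"
        using x subspace_diff[OF assms] by auto
      then show "y \<in> x +o I" unfolding elt_set_plus_def by blast
    qed
  qed
qed

lemma quot_mult_coset:
  assumes I: "is_ideal I" and x: "x \<in> A" and y: "y \<in> A"
  shows "quot_mult I (x +o I) (y +o I) = (x \<bullet> y) +o I"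
proof -
  have sub: "subspace I" and IA: "I \<subseteq> A"
    using I by (auto simp: is_ideal_def)
  have "((x + a) \<bullet> (y + b)) +o I = (x \<bullet> y) +o I" if ab: "a \<in> I" "b \<in> I" for a b
  proof -
    have A: "a \<in> A" "b \<in> A" "x + a \<in> A"
      using ab IA x subspace_add[OF subspace_A] by auto
    have "(x + a) \<bullet> (y + b) = x \<bullet> y + (a \<bullet> y + (x \<bullet> b + a \<bullet> b))"
      using A x y by (simp add: mult_add_left mult_add_right algebra_simps)
    moreover have "a \<bullet> y + (x \<bullet> b + a \<bullet> b) \<in> I"
      using I ab A x y subspace_add[OF sub] by (auto simp: is_ideal_def)
    ultimately show ?thesis
      by (metis coset_eq_self_iff[OF sub] set_plus_rearrange2)
  qed
  moreover have "0 \<in> I" using subspace_0[OF sub] .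
  ultimately show ?thesis
    unfolding quot_mult_def elt_set_plus_def[of x] elt_set_plus_def[of y]
    by (auto 4 4)
qed

lemma ann_series_Suc_step:
  assumes I: "is_ideal (ann_series i)"
  shows "ann_series (Suc i) =
    {x \<in> A. \<forall>y\<in>A. x \<bullet> y \<in> ann_series i \<and> y \<bullet> x \<in> ann_series i}"
proof -
  have sub: "subspace (ann_series i)"
    using I by (simp add: is_ideal_def)
  have "x +o ann_series i \<in>
      annihilator (quot (ann_series i)) (quot_mult (ann_series i)) (ann_series i)
      \<longleftrightarrow> (\<forall>y\<in>A. x \<bullet> y \<in> ann_series i \<and> y \<bullet> x \<in> ann_series i)"
    if "x \<in> A" for x
    using that
    by (simp add: annihilator_def quot_def quot_mult_coset[OF I] coset_eq_self_iff[OF sub])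
  then show ?thesis by auto
qed

lemma is_ideal_ann_series: "is_ideal (ann_series i)"
proof (induction i)
  case 0
  have "x \<bullet> 0 = 0 \<and> 0 \<bullet> x = 0" if "x \<in> A" for x
    using that mult_scale_left[of x x 0] mult_scale_right[of x x 0] by simp
  then show ?case
    using subspace_0[OF subspace_A] by (simp add: is_ideal_def subspace_single_0)
next
  case (Suc i)
  have sub: "subspace (ann_series i)" and "ann_series i \<subseteq> A"
    using Suc.IH by (auto simp: is_ideal_def)
  have 0: "x \<bullet> 0 = 0 \<and> 0 \<bullet> x = 0" if "x \<in> A" for x
    using that mult_scale_left[of x x 0] mult_scale_right[of x x 0] by simp
  show ?case
    unfolding is_ideal_def ann_series_Suc_step[OF Suc.IH] subspace_def
    using Suc.IH sub subspace_A
    by (auto simp: is_ideal_def subspace_def 0 mult_add_left mult_add_right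
        mult_scale_left mult_scale_right mult_closed)
qed

lemma ann_series_Suc_iff:
  "ann_series (Suc i) =
    {x \<in> A. \<forall>y\<in>A. x \<bullet> y \<in> ann_series i \<and> y \<bullet> x \<in> ann_series i}"
  by (rule ann_series_Suc_step[OF is_ideal_ann_series])

lemma ann_series_1: "ann_series 1 = annihilator A (\<bullet>) 0"
  by (simp add: ann_series_Suc_iff annihilator_def del: ann_series.simps(2))

end

locale evolution_algebra = nonassoc_algebra +
  assumes ex_natural_basis: "\<exists>B. natural_basis B"

definition bilinear_form ::
    "('f::field \<Rightarrow> 'u::ab_group_add \<Rightarrow> 'u) \<Rightarrow> ('u \<Rightarrow> 'u \<Rightarrow> 'f) \<Rightarrow> bool" where
  "bilinear_form s b \<longleftrightarrow>
     (\<forall>x. Vector_Spaces.linear s (*) (\<lambda>y. b x y)) \<and>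
     (\<forall>y. Vector_Spaces.linear s (*) (\<lambda>x. b x y))"

definition symmetric_form :: "('u \<Rightarrow> 'u \<Rightarrow> 'f) \<Rightarrow> bool" where
  "symmetric_form b \<longleftrightarrow> (\<forall>x y. b x y = b y x)"

text \<open>Only the left radical is mentioned; for symmetric forms it is the right radical too.\<close>

definition nondegenerate_form :: "('u::zero \<Rightarrow> 'u \<Rightarrow> 'f::zero) \<Rightarrow> bool" where
  "nondegenerate_form b \<longleftrightarrow> (\<forall>x. (\<forall>y. b x y = 0) \<longrightarrow> x = 0)"

text \<open>Tuples \<open>(\<alpha>\<^sub>1, \<dots>, \<alpha>\<^sub>l)\<close> are functions \<open>nat \<Rightarrow> 'f\<close> vanishing
  outside \<open>{1..l}\<close>.\<close>

definition tuples :: "nat \<Rightarrow> (nat \<Rightarrow> 'f::zero) set" where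
  "tuples k = {\<alpha>. \<forall>i. i \<notin> {1..k} \<longrightarrow> \<alpha> i = 0}"

definition E_carrier :: "nat \<Rightarrow> nat \<Rightarrow> ((nat \<Rightarrow> 'f::zero) \<times> 'u \<times> (nat \<Rightarrow> 'f)) set" where
  "E_carrier l r = tuples l \<times> UNIV \<times> tuples r"

definition E_scale :: "('f::field \<Rightarrow> 'u \<Rightarrow> 'u) \<Rightarrow> 'f \<Rightarrow>
    (nat \<Rightarrow> 'f) \<times> 'u \<times> (nat \<Rightarrow> 'f) \<Rightarrow> (nat \<Rightarrow> 'f) \<times> 'u \<times> (nat \<Rightarrow> 'f)" where
  "E_scale s c = (\<lambda>(\<alpha>, x, \<beta>). (\<lambda>i. c * \<alpha> i, s c x, \<lambda>j. c * \<beta> j))"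

definition E_mult :: "('f::field \<Rightarrow> 'u \<Rightarrow> 'u) \<Rightarrow> nat \<Rightarrow> nat \<Rightarrow> ('u \<Rightarrow> 'u \<Rightarrow> 'f) \<Rightarrow> 'u \<Rightarrow>
    (nat \<Rightarrow> 'f) \<times> 'u \<times> (nat \<Rightarrow> 'f) \<Rightarrow> (nat \<Rightarrow> 'f) \<times> 'u \<times> (nat \<Rightarrow> 'f) \<Rightarrow>
    (nat \<Rightarrow> 'f) \<times> 'u \<times> (nat \<Rightarrow> 'f)" where
  "E_mult s l r b u = (\<lambda>(\<alpha>, x, \<beta>) (\<gamma>, y, \<delta>).
     (\<lambda>i. if i \<in> {2..l} then \<alpha> (i - 1) * \<gamma> (i - 1) else 0,
      s (\<alpha> l * \<gamma> l) u,
      \<lambda>j. if j = 1 then b x y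
          else if j \<in> {2..r} then \<beta> (j - 1) * \<delta> (j - 1) else 0))"

end

theory Submission
  imports Defs
begin

text \<open>
  The product moves every coordinate of \<open>E\<^sub>l\<^sub>r(U, b, u)\<close> one place to the right: a left coordinate to
  its neighbour, the last left coordinate into \<open>U\<close> along \<open>u\<close>, the vector in \<open>U\<close> through \<open>b\<close> to the
  first right coordinate, and the last right coordinate to zero. Apart from the last one, none of
  these moves kills a nonzero entry under multiplication by every element: scalars multiply without
  zero divisors, \<open>u\<close> is nonzero, and \<open>b\<close> is nondegenerate.
  Hence an element lies in the \<open>t\<close>-th term of the annihilator series exactly if its entries sit in
  the last \<open>t\<close> of the \<open>r + 1 + l\<close> places (\<open>ann_series_eq_block\<close>). The place of \<open>U\<close> has dimension \<open>n\<close>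
  and every other place has dimension one, which gives the type.

  Nilpotency follows because the annihilator series reaches the whole algebra
  (\<open>nilpotent_if_ann_series_eq\<close>). In any nonassociative algebra a product of \<open>2\<^sup>k\<close> factors, however
  bracketed, contains a chain of \<open>k\<close> nested multiplications, and each of them descends one term of
  the series.

  A natural basis consists of the unit vectors of the scalar places together with a \<open>b\<close>-orthogonal
  basis of \<open>U\<close> (\<open>ex_orthogonal_basis\<close>); the latter exists since the characteristic is not two.
\<close>

section \<open>Nilpotency from the annihilator series\<close>

context nonassoc_algebra
begin

lemma subspace_ann_series: "subspace (ann_series i)"
  using is_ideal_ann_series[of i] by (auto simp: is_ideal_def)

lemma sum_sets_subset_subspace:
  assumes "finite K" and "subspace S" and "\<And>i. i \<in> K \<Longrightarrow> T i \<subseteq> S"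
  shows "sum T K \<subseteq> S"
  using assms(1,3)
proof (induction K)
  case empty
  then show ?case
    using subspace_0[OF assms(2)] by (simp add: set_zero)
next
  case (insert i K)
  then have "T i \<subseteq> S" "sum T K \<subseteq> S"
    by auto
  then show ?case
    using insert.hyps subspace_add[OF assms(2)] by (auto simp: set_plus_def)
qed

lemma zero_in_sum_sets:
  assumes "finite K" and "\<And>i. i \<in> K \<Longrightarrow> 0 \<in> T i"
  shows "0 \<in> sum T K"
  using assms
proof (induction K)
  case (insert i K)
  then have "0 + 0 \<in> T i + sum T K"
    by (intro set_plus_intro) auto
  then show ?case
    using insert.hyps by simp
qed (simp add: set_zero)

lemma alg_power_subset_subspace:
  assumes "2 \<le> m" and "subspace S"
    and "\<And>i x y. \<lbrakk>1 \<le> i; i < m; x \<in> alg_power i; y \<in> alg_power (m - i)\<rbrakk> \<Longrightarrow> x \<bullet> y \<in> S"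
  shows "alg_power m \<subseteq> S"
proof -
  have "alg_power m = (\<Sum>i\<in>{1..<m}. subspace_prod (alg_power i) (alg_power (m - i)))"
    using assms(1) by (subst alg_power.simps) simp
  moreover have "subspace_prod (alg_power i) (alg_power (m - i)) \<subseteq> S" if "i \<in> {1..<m}" for i
    unfolding subspace_prod_def using assms that by (intro span_minimal) auto
  ultimately show ?thesis
    using sum_sets_subset_subspace[OF finite_atLeastLessThan assms(2)] by simp
qed

lemma alg_power_subset: "alg_power m \<subseteq> A"
proof (induction m rule: less_induct)
  case (less m)
  show ?case
  proof (cases "m \<le> 1")
    case True
    then show ?thesis
      by (subst alg_power.simps) simp
  next
    case False
    show ?thesis
    proof (rule alg_power_subset_subspace[OF _ subspace_A])
      fix i x y
      assume "1 \<le> i" "i < m" "x \<in> alg_power i" "y \<in> alg_power (m - i)"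
      then show "x \<bullet> y \<in> A"
        using less.IH[of i] less.IH[of "m - i"] mult_closed by auto
    qed (use False in simp)
  qed
qed

lemma zero_in_alg_power: "0 \<in> alg_power m"
  using subspace_0[OF subspace_A]
  by (subst alg_power.simps) (auto simp: subspace_prod_def span_zero intro!: zero_in_sum_sets)

text \<open>In a product from \<open>E\<^sup>i E\<^sup>m\<^sup>-\<^sup>i\<close> one of the two exponents is at least \<open>m / 2\<close>, and
  multiplying by any element lowers the position in the annihilator series by one. So each doubling
  of the exponent descends one step.\<close>

lemma alg_power_subset_ann_series:
  assumes "ann_series s = A" and "2 ^ k \<le> m" and "k \<le> s"
  shows "alg_power m \<subseteq> ann_series (s - k)"
  using assms(2,3)
proof (induction k arbitrary: m)
  case 0
  then show ?case
    using assms(1) alg_power_subset by simp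
next
  case (Suc k)
  have step: "ann_series (s - k) =
      {x \<in> A. \<forall>y\<in>A. x \<bullet> y \<in> ann_series (s - Suc k) \<and> y \<bullet> x \<in> ann_series (s - Suc k)}"
    using Suc.prems(2) ann_series_Suc_iff[of "s - Suc k"] by (simp add: Suc_diff_Suc)
  show ?case
  proof (rule alg_power_subset_subspace[OF _ subspace_ann_series])
    show "2 \<le> m"
      using Suc.prems(1) one_le_power[of "2::nat" k] unfolding power_Suc by linarith
  next
    fix i x y
    assume i: "1 \<le> i" "i < m" and x: "x \<in> alg_power i" and y: "y \<in> alg_power (m - i)"
    have A: "x \<in> A" "y \<in> A"
      using x y alg_power_subset by auto
    have "2 ^ k \<le> i \<or> 2 ^ k \<le> m - i"
      using Suc.prems(1) i by auto
    then have "x \<in> ann_series (s - k) \<or> y \<in> ann_series (s - k)"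
      using Suc.IH[of i] Suc.IH[of "m - i"] Suc.prems(2) x y by auto
    then show "x \<bullet> y \<in> ann_series (s - Suc k)"
      using A unfolding step by blast
  qed
qed

lemma nilpotent_if_ann_series_eq:
  assumes "ann_series s = A"
  shows nilpotent
proof -
  have "alg_power (2 ^ s) \<subseteq> {0}"
    using alg_power_subset_ann_series[OF assms order_refl order_refl] by simp
  then have "alg_power (2 ^ s) = {0}"
    using zero_in_alg_power by blast
  then show ?thesis
    unfolding nilpotent_def by (intro exI[of _ "2 ^ s"]) simp
qed

end

section \<open>Orthogonal bases of symmetric bilinear forms\<close>

lemma two_neq_zero_if_CHAR_neq_2:
  assumes "CHAR('f::field) \<noteq> 2"
  shows "(2 :: 'f) \<noteq> 0"
proof
  assume "(2 :: 'f) = 0"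
  then have "of_nat 2 = (0 :: 'f)"
    by simp
  then have "CHAR('f) dvd 2"
    by (simp only: of_nat_eq_0_iff_char_dvd)
  then have "CHAR('f) = 1 \<or> CHAR('f) = 2"
    using two_is_prime_nat by (auto simp: prime_nat_iff)
  then show False
    using assms CHAR_not_1[where 'a = 'f] by simp
qed

context vector_space
begin

lemma bilinear_formD:
  assumes "bilinear_form scale b"
  shows "b (x + x') y = b x y + b x' y" and "b x (y + y') = b x y + b x y'"
    and "b (scale c x) y = c * b x y" and "b x (scale c y) = c * b x y"
    and "b 0 y = 0" and "b x 0 = 0"
proof -
  interpret left: Vector_Spaces.linear scale "(*)" "\<lambda>x. b x y"
    using assms by (simp add: bilinear_form_def)
  interpret right: Vector_Spaces.linear scale "(*)" "\<lambda>y. b x y"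
    using assms by (simp add: bilinear_form_def)
  show "b (x + x') y = b x y + b x' y" "b (scale c x) y = c * b x y" "b 0 y = 0"
    by (rule left.add left.scale left.zero)+
  show "b x (y + y') = b x y + b x y'" "b x (scale c y) = c * b x y" "b x 0 = 0"
    by (rule right.add right.scale right.zero)+
qed

text \<open>Polarization: \<open>2 b(x, y) = b(x + y, x + y) - b(x, x) - b(y, y)\<close>.\<close>

lemma ex_anisotropic_vector:
  assumes "(2 :: 'a) \<noteq> 0" and "bilinear_form scale b" and "symmetric_form b"
    and "subspace W" and "x \<in> W" and "y \<in> W" and "b x y \<noteq> 0"
  shows "\<exists>z\<in>W. b z z \<noteq> 0"
proof (rule ccontr)
  assume "\<not> ?thesis"
  then have iso: "b z z = 0" if "z \<in> W" for z
    using that by blast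
  have "b (x + y) (x + y) = b x x + b y y + 2 * b x y"
    using assms(3) by (simp add: bilinear_formD[OF assms(2)] symmetric_form_def)
  then have "2 * b x y = 0"
    using iso assms(4-6) subspace_add by simp
  then show False
    using assms(1,7) by simp
qed

end

context finite_dimensional_vector_space
begin

text \<open>Induction on the dimension: unless the form vanishes on \<open>W\<close>, some \<open>z\<close> in \<open>W\<close> is anisotropic,
  and \<open>W\<close> splits into the line of \<open>z\<close> and the smaller subspace orthogonal to \<open>z\<close>.\<close>

lemma ex_orthogonal_basis:
  assumes "(2 :: 'a) \<noteq> 0" and "bilinear_form scale b" and "symmetric_form b" and "subspace W"
  shows "\<exists>C. independent C \<and> span C = W \<and> (\<forall>x\<in>C. \<forall>y\<in>C. x \<noteq> y \<longrightarrow> b x y = 0)"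
  using assms(4)
proof (induction "dim W" arbitrary: W rule: less_induct)
  case less
  note b = bilinear_formD[OF assms(2)]
  show ?case
  proof (cases "\<forall>x\<in>W. \<forall>y\<in>W. b x y = 0")
    case True
    obtain C where C: "C \<subseteq> W" "independent C" "W \<subseteq> span C"
      using maximal_independent_subset[of W] by blast
    then have "span C = W"
      using span_subspace less.prems by blast
    then show ?thesis
      using True C by blast
  next
    case False
    then obtain z where z: "z \<in> W" "b z z \<noteq> 0"
      using ex_anisotropic_vector[OF assms(1-3) less.prems] by blast
    define W' where "W' = {w \<in> W. b z w = 0}"
    have W': "subspace W'"
      using less.prems by (auto simp: W'_def subspace_def b)
    have "W' \<subset> W"
      using z by (auto simp: W'_def)
    then have "dim W' < dim W"
      using W' less.prems by (metis dim_psubset span_eq_iff)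
    then obtain C where C: "independent C" "span C = W'"
      and orth: "\<forall>x\<in>C. \<forall>y\<in>C. x \<noteq> y \<longrightarrow> b x y = 0"
      using less.hyps[OF _ W'] by blast
    have CW: "C \<subseteq> W'"
      using C span_superset by blast
    have "z \<notin> span C"
      using z C by (simp add: W'_def)
    then have "independent (insert z C)"
      using C independent_insertI by blast
    moreover have "span (insert z C) = W"
    proof
      show "span (insert z C) \<subseteq> W"
        using z CW less.prems by (intro span_minimal) (auto simp: W'_def)
      show "W \<subseteq> span (insert z C)"
      proof
        fix w assume w: "w \<in> W"
        \<comment> \<open>the coefficient of the orthogonal projection of \<open>w\<close> to the line of \<open>z\<close>\<close>
        define c where "c = b z w / b z z"
        have "b z (w + scale (- c) z) = 0"
          using z(2) unfolding b by (simp add: c_def)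
        then have "w - scale c z \<in> span C"
          using w z(1) less.prems C(2) by (auto simp: W'_def intro!: subspace_diff subspace_scale)
        then show "w \<in> span (insert z C)"
          unfolding span_insert by blast
      qed
    qed
    moreover have "b z x = 0 \<and> b x z = 0" if "x \<in> C" for x
      using that CW assms(3) by (auto simp: W'_def symmetric_form_def)
    ultimately show ?thesis
      using orth by (intro exI[of _ "insert z C"]) auto
  qed
qed

end

section \<open>Coordinate blocks and their bases\<close>

text \<open>The terms of the annihilator series and the algebra itself all have this form: some left
  coordinates, a set of middle components, and some right coordinates.\<close>

definition block :: "nat set \<Rightarrow> 'u set \<Rightarrow> nat set \<Rightarrow> ((nat \<Rightarrow> 'f::zero) \<times> 'u \<times> (nat \<Rightarrow> 'f)) set" where
  "block I X J = {(\<alpha>, x, \<beta>). (\<forall>i. i \<notin> I \<longrightarrow> \<alpha> i = 0) \<and> x \<in> X \<and> (\<forall>j. j \<notin> J \<longrightarrow> \<beta> j = 0)}"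

definition unit_fun :: "nat \<Rightarrow> nat \<Rightarrow> 'f::zero_neq_one" where
  "unit_fun i = (\<lambda>j. if j = i then 1 else 0)"

definition left_unit :: "nat \<Rightarrow> (nat \<Rightarrow> 'f::zero_neq_one) \<times> 'u::zero \<times> (nat \<Rightarrow> 'f)" where
  "left_unit i = (unit_fun i, 0, 0)"

definition middle :: "'u \<Rightarrow> (nat \<Rightarrow> 'f::zero) \<times> 'u \<times> (nat \<Rightarrow> 'f)" where
  "middle x = (0, x, 0)"

definition right_unit :: "nat \<Rightarrow> (nat \<Rightarrow> 'f::zero_neq_one) \<times> 'u::zero \<times> (nat \<Rightarrow> 'f)" where
  "right_unit j = (0, 0, unit_fun j)"

definition block_basis :: "nat set \<Rightarrow> 'u set \<Rightarrow> nat set \<Rightarrow>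
    ((nat \<Rightarrow> 'f::zero_neq_one) \<times> 'u::zero \<times> (nat \<Rightarrow> 'f)) set" where
  "block_basis I C J = left_unit ` I \<union> middle ` C \<union> right_unit ` J"

lemmas unit_defs = left_unit_def middle_def right_unit_def unit_fun_def

lemma E_carrier_eq_block: "E_carrier l r = block {0<..l} UNIV {0<..r}"
  by (auto simp: E_carrier_def tuples_def block_def Suc_le_eq)

lemma inj_left_unit: "inj left_unit" and inj_middle: "inj middle" and inj_right_unit: "inj right_unit"
  by (auto simp: inj_def unit_defs fun_eq_iff split: if_splits)

lemma E_scale_Pair: "E_scale s c (\<alpha>, x, \<beta>) = (\<lambda>i. c * \<alpha> i, s c x, \<lambda>j. c * \<beta> j)"
  by (simp add: E_scale_def)

lemma vector_space_E_scale:
  assumes "vector_space s"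
  shows "vector_space (E_scale s)"
proof -
  interpret vector_space s
    by fact
  show ?thesis
    by standard
      (auto simp: E_scale_def fun_eq_iff algebra_simps scale_left_distrib scale_right_distrib)
qed

context vector_space
begin

interpretation E: vector_space "E_scale scale"
  by (rule vector_space_E_scale) unfold_locales

lemma E_subspace_block:
  assumes "subspace X"
  shows "E.subspace (block I X J)"
  using assms by (auto simp: E.subspace_def subspace_def block_def E_scale_def zero_prod_def)

lemma E_span_block_basis_subset: "E.span (block_basis I C J) \<subseteq> block I (span C) J"
  by (intro E.span_minimal E_subspace_block subspace_span)
    (auto simp: block_basis_def block_def unit_defs span_zero span_base)

lemma left_in_E_span:
  assumes "finite I" and "\<forall>i. i \<notin> I \<longrightarrow> \<alpha> i = 0"
  shows "(\<alpha>, 0, 0) \<in> E.span (left_unit ` I)"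
  using assms
proof (induction I arbitrary: \<alpha>)
  case empty
  then have "(\<alpha>, 0, 0) = (0 :: (nat \<Rightarrow> 'a) \<times> 'b \<times> (nat \<Rightarrow> 'a))"
    by (auto simp: zero_prod_def)
  then show ?case
    by (simp only: E.span_zero)
next
  case (insert i I)
  have "(\<alpha>(i := 0), 0, 0) \<in> E.span (left_unit ` I)"
    by (rule insert.IH) (use insert.prems in auto)
  then have "(\<alpha>(i := 0), 0, 0) \<in> E.span (left_unit ` insert i I)"
    by (rule E.span_mono[THEN subsetD, rotated]) auto
  moreover have "(\<alpha>, 0, 0) = (\<alpha>(i := 0), 0, 0) + E_scale scale (\<alpha> i) (left_unit i)"
    by (auto simp: E_scale_def unit_defs fun_eq_iff)
  ultimately show ?case
    by (simp only: E.span_add E.span_scale E.span_base image_insert insertI1)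
qed

lemma right_in_E_span:
  assumes "finite J" and "\<forall>j. j \<notin> J \<longrightarrow> \<beta> j = 0"
  shows "(0, 0, \<beta>) \<in> E.span (right_unit ` J)"
  using assms
proof (induction J arbitrary: \<beta>)
  case empty
  then have "(0, 0, \<beta>) = (0 :: (nat \<Rightarrow> 'a) \<times> 'b \<times> (nat \<Rightarrow> 'a))"
    by (auto simp: zero_prod_def)
  then show ?case
    by (simp only: E.span_zero)
next
  case (insert j J)
  have "(0, 0, \<beta>(j := 0)) \<in> E.span (right_unit ` J)"
    by (rule insert.IH) (use insert.prems in auto)
  then have "(0, 0, \<beta>(j := 0)) \<in> E.span (right_unit ` insert j J)"
    by (rule E.span_mono[THEN subsetD, rotated]) auto
  moreover have "(0, 0, \<beta>) = (0, 0, \<beta>(j := 0)) + E_scale scale (\<beta> j) (right_unit j)"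
    by (auto simp: E_scale_def unit_defs fun_eq_iff)
  ultimately show ?case
    by (simp only: E.span_add E.span_scale E.span_base image_insert insertI1)
qed

lemma middle_in_E_span:
  assumes "x \<in> span C"
  shows "middle x \<in> E.span (middle ` C)"
  using assms
proof (induction rule: span_induct_alt)
  case base
  have "middle 0 = (0 :: (nat \<Rightarrow> 'a) \<times> 'b \<times> (nat \<Rightarrow> 'a))"
    by (simp add: middle_def zero_prod_def)
  then show ?case
    by (simp only: E.span_zero)
next
  case (step c x y)
  have "middle (scale c x + y) = E_scale scale c (middle x) + middle y"
    by (auto simp: middle_def E_scale_def fun_eq_iff)
  then show ?case
    using step by (auto intro!: E.span_add E.span_scale intro: E.span_base)
qed

lemma E_span_block_basis:
  assumes "finite I" and "finite J"
  shows "E.span (block_basis I C J) = block I (span C) J"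
proof
  show "block I (span C) J \<subseteq> E.span (block_basis I C J)"
  proof
    fix p :: "(nat \<Rightarrow> 'a) \<times> 'b \<times> (nat \<Rightarrow> 'a)"
    assume "p \<in> block I (span C) J"
    then obtain \<alpha> x \<beta> where p: "p = (\<alpha>, x, \<beta>)"
      and supp: "\<forall>i. i \<notin> I \<longrightarrow> \<alpha> i = 0" "x \<in> span C" "\<forall>j. j \<notin> J \<longrightarrow> \<beta> j = 0"
      by (auto simp: block_def)
    have "p = (\<alpha>, 0, 0) + middle x + (0, 0, \<beta>)"
      by (simp add: p middle_def)
    moreover have "(\<alpha>, 0, 0) \<in> E.span (block_basis I C J)"
      using left_in_E_span[OF assms(1) supp(1)] E.span_mono[of "left_unit ` I" "block_basis I C J"]
      by (auto simp: block_basis_def)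
    moreover have "middle x \<in> E.span (block_basis I C J)"
      using middle_in_E_span[OF supp(2)] E.span_mono[of "middle ` C" "block_basis I C J"]
      by (auto simp: block_basis_def)
    moreover have "(0, 0, \<beta>) \<in> E.span (block_basis I C J)"
      using right_in_E_span[OF assms(2) supp(3)] E.span_mono[of "right_unit ` J" "block_basis I C J"]
      by (auto simp: block_basis_def)
    ultimately show "p \<in> E.span (block_basis I C J)"
      by (auto intro!: E.span_add)
  qed
qed (rule E_span_block_basis_subset)

text \<open>Removing one vector from the basis removes an index, or a vector of \<open>C\<close>, from the block that
  contains its span; the removed vector lies outside the smaller block.\<close>

lemma E_independent_block_basis:
  assumes "independent C"
  shows "E.independent (block_basis I C J)"
proof
  assume "E.dependent (block_basis I C J)"
  then obtain p where p: "p \<in> block_basis I C J" "p \<in> E.span (block_basis I C J - {p})"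
    by (auto simp: E.dependent_def)
  have sub: "p \<in> block I' (span C') J'" if "block_basis I C J - {p} \<subseteq> block_basis I' C' J'" for I' C' J'
    using p(2) E.span_mono[OF that] E_span_block_basis_subset[of I' C' J'] by blast
  consider i where "i \<in> I" "p = left_unit i" | x where "x \<in> C" "p = middle x"
    | j where "j \<in> J" "p = right_unit j"
    using p(1) by (auto simp: block_basis_def)
  then show False
  proof cases
    case 1
    have "p \<in> block (I - {i}) (span C) J"
      by (rule sub) (auto simp: block_basis_def 1)
    then show False
      by (auto simp: 1 block_def unit_defs)
  next
    case 2
    have "p \<in> block I (span (C - {x})) J"
      by (rule sub) (auto simp: block_basis_def 2)
    then show False
      using assms 2(1) by (auto simp: 2(2) block_def unit_defs dependent_def)
  next
    case 3
    have "p \<in> block I (span C) (J - {j})"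
      by (rule sub) (auto simp: block_basis_def 3)
    then show False
      by (auto simp: 3 block_def unit_defs)
  qed
qed

lemma card_block_basis:
  assumes "finite I" and "finite C" and "finite J" and "0 \<notin> C"
  shows "card (block_basis I C J :: ((nat \<Rightarrow> 'f::zero_neq_one) \<times> 'b \<times> (nat \<Rightarrow> 'f)) set) =
    card I + card C + card J"
proof -
  let ?L = "left_unit ` I :: ((nat \<Rightarrow> 'f) \<times> 'b \<times> (nat \<Rightarrow> 'f)) set"
  let ?M = "middle ` C :: ((nat \<Rightarrow> 'f) \<times> 'b \<times> (nat \<Rightarrow> 'f)) set"
  let ?R = "right_unit ` J :: ((nat \<Rightarrow> 'f) \<times> 'b \<times> (nat \<Rightarrow> 'f)) set"
  have "?L \<inter> ?M = {}" "(?L \<union> ?M) \<inter> ?R = {}"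
    using assms(4) by (auto simp: unit_defs fun_eq_iff split: if_splits)
  moreover have "card ?L = card I" "card ?M = card C" "card ?R = card J"
    by (auto intro!: card_image intro: inj_on_subset[OF inj_left_unit] inj_on_subset[OF inj_middle]
        inj_on_subset[OF inj_right_unit])
  ultimately show ?thesis
    using assms(1-3) by (simp add: block_basis_def card_Un_disjoint)
qed

end

lemma (in finite_dimensional_vector_space) E_dim_block:
  assumes "finite I" and "finite J" and "subspace X"
  shows "vector_space.dim (E_scale scale) (block I X J) = card I + dim X + card J"
proof -
  interpret E: vector_space "E_scale scale"
    by (rule vector_space_E_scale) unfold_locales
  obtain C where C: "C \<subseteq> X" "independent C" "X \<subseteq> span C" "card C = dim X"
    using basis_exists[of X] by blast
  then have X: "span C = X"
    using span_subspace assms(3) by blast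
  have "finite C"
    using C(2) finiteI_independent by blast
  moreover have "0 \<notin> C"
    using C(2) dependent_zero by blast
  ultimately have "card (block_basis I C J :: ((nat \<Rightarrow> 'a) \<times> 'b \<times> (nat \<Rightarrow> 'a)) set) =
      card I + dim X + card J"
    using assms C(4) by (simp add: card_block_basis)
  then show ?thesis
    using E.dim_eq_card[OF _ E_independent_block_basis[OF C(2)], of I J "block I X J"]
      E_span_block_basis[OF assms(1,2)] E_subspace_block[OF assms(3), of I J] X E.span_eq_iff
    by metis
qed

section \<open>The algebra and its annihilator series\<close>

locale E_lr_algebra = finite_dimensional_vector_space sU BU
  for sU :: "'f::field \<Rightarrow> 'u::ab_group_add \<Rightarrow> 'u" and BU :: "'u set" +
  fixes b :: "'u \<Rightarrow> 'u \<Rightarrow> 'f" and u :: 'u and l r :: nat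
  assumes bilinear: "bilinear_form sU b" and symmetric: "symmetric_form b"
    and nondegenerate: "nondegenerate_form b" and u_nonzero: "u \<noteq> 0"
    and l_pos: "l \<ge> 1" and r_pos: "r \<ge> 1"
begin

lemmas b_simps = bilinear_formD[OF bilinear]

lemma E_mult_Pair:
  "E_mult sU l r b u (\<alpha>, x, \<beta>) (\<gamma>, y, \<delta>) =
    (\<lambda>i. if i \<in> {2..l} then \<alpha> (i - 1) * \<gamma> (i - 1) else 0,
     sU (\<alpha> l * \<gamma> l) u,
     \<lambda>j. if j = 1 then b x y else if j \<in> {2..r} then \<beta> (j - 1) * \<delta> (j - 1) else 0)"
  by (simp add: E_mult_def)

lemma E_mult_commute: "E_mult sU l r b u p q = E_mult sU l r b u q p"
  using symmetric
  by (cases p; cases q) (auto simp: E_mult_Pair symmetric_form_def fun_eq_iff mult.commute)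

sublocale E: nonassoc_algebra "E_scale sU" "E_carrier l r" "E_mult sU l r b u"
proof -
  interpret E: vector_space "E_scale sU"
    by (rule vector_space_E_scale) unfold_locales
  show "nonassoc_algebra (E_scale sU) (E_carrier l r) (E_mult sU l r b u)"
  proof
    show "E.subspace (E_carrier l r)"
      unfolding E_carrier_eq_block by (rule E_subspace_block) simp
  next
    fix p q :: "(nat \<Rightarrow> 'f) \<times> 'u \<times> (nat \<Rightarrow> 'f)"
    assume "p \<in> E_carrier l r" "q \<in> E_carrier l r"
    then show "E_mult sU l r b u p q \<in> E_carrier l r"
      using r_pos by (cases p; cases q) (auto simp: E_mult_Pair E_carrier_def tuples_def)
  next
    fix p q p' :: "(nat \<Rightarrow> 'f) \<times> 'u \<times> (nat \<Rightarrow> 'f)"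
    have add: "E_mult sU l r b u (p + q) p' = E_mult sU l r b u p p' + E_mult sU l r b u q p'" for p q p'
      by (cases p; cases q; cases p')
        (auto simp: E_mult_Pair fun_eq_iff b_simps algebra_simps scale_left_distrib)
    show "E_mult sU l r b u (p + q) p' = E_mult sU l r b u p p' + E_mult sU l r b u q p'"
      by (rule add)
    show "E_mult sU l r b u p (q + p') = E_mult sU l r b u p q + E_mult sU l r b u p p'"
      using add by (simp add: E_mult_commute[of p])
  next
    fix c and p q :: "(nat \<Rightarrow> 'f) \<times> 'u \<times> (nat \<Rightarrow> 'f)"
    have scale: "E_mult sU l r b u (E_scale sU c p) q = E_scale sU c (E_mult sU l r b u p q)" for p q
      by (cases p; cases q) (auto simp: E_mult_Pair E_scale_Pair fun_eq_iff b_simps algebra_simps)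
    show "E_mult sU l r b u (E_scale sU c p) q = E_scale sU c (E_mult sU l r b u p q)"
      by (rule scale)
    show "E_mult sU l r b u p (E_scale sU c q) = E_scale sU c (E_mult sU l r b u p q)"
      using scale by (simp add: E_mult_commute[of p])
  qed
qed

text \<open>Nondegeneracy is what forces \<open>x = 0\<close> here. For the other components the single element with
  all scalar coordinates equal to one suffices as a test.\<close>

lemma mult_mem_block_iff:
  assumes "(\<alpha>, x, \<beta>) \<in> E_carrier l r" and "subspace X"
  shows "(\<forall>q\<in>E_carrier l r. E_mult sU l r b u (\<alpha>, x, \<beta>) q \<in> block I X J) \<longleftrightarrow>
    (\<forall>i\<in>{2..l} - I. \<alpha> (i - 1) = 0) \<and> sU (\<alpha> l) u \<in> X \<and>
    (1 \<notin> J \<longrightarrow> x = 0) \<and> (\<forall>j\<in>{2..r} - J. \<beta> (j - 1) = 0)"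
    (is "?L \<longleftrightarrow> ?R")
proof
  assume L: ?L
  define ones where "ones k = (\<lambda>i. if i \<in> {1..k} then 1 else 0 :: 'f)" for k :: nat
  have "E_mult sU l r b u (\<alpha>, x, \<beta>) (ones l, y, ones r) \<in> block I X J" for y
    using L by (auto simp: E_carrier_def tuples_def ones_def)
  then have *: "(\<forall>i. i \<notin> I \<longrightarrow> i \<in> {2..l} \<longrightarrow> \<alpha> (i - 1) * ones l (i - 1) = 0) \<and>
      sU (\<alpha> l * ones l l) u \<in> X \<and> (1 \<notin> J \<longrightarrow> b x y = 0) \<and>
      (\<forall>j. j \<notin> J \<longrightarrow> j \<in> {2..r} \<longrightarrow> \<beta> (j - 1) * ones r (j - 1) = 0)" for y
    unfolding E_mult_Pair block_def by (fastforce split: if_splits)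
  have "\<alpha> (i - 1) = 0" if "i \<in> {2..l} - I" for i
    using *[of 0] that by (auto simp: ones_def split: if_splits)
  moreover have "\<beta> (j - 1) = 0" if "j \<in> {2..r} - J" for j
    using *[of 0] that by (auto simp: ones_def split: if_splits)
  moreover have "sU (\<alpha> l) u \<in> X"
    using *[of 0] l_pos by (simp add: ones_def)
  moreover have "x = 0" if "1 \<notin> J"
    using * that nondegenerate by (auto simp: nondegenerate_form_def)
  ultimately show ?R
    by blast
next
  assume R: ?R
  have "sU (\<alpha> l * c) u \<in> X" for c
    using R subspace_scale[OF assms(2), of "sU (\<alpha> l) u" c] by (simp add: mult.commute)
  then show ?L
    using R by (auto simp: E_mult_Pair block_def b_simps split: if_splits)
qed

text \<open>The series collects the places from right to left, one per step, the middle component being the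
  step from \<open>r\<close> to \<open>r + 1\<close>. Truncated subtraction lets one formula describe the steps before and
  after it.\<close>

lemma ann_series_eq_block:
  "E.ann_series t =
    block {l - (t - Suc r)<..l} (if t \<le> r then {0} else UNIV) {r - t<..r}"
proof (induction t)
  case 0
  then show ?case
    by (auto simp: block_def zero_prod_def fun_eq_iff)
next
  case (Suc t)
  let ?X = "if t \<le> r then {0} else UNIV :: 'u set"
  have X: "subspace ?X"
    by (simp add: subspace_single_0)
  have "E.ann_series (Suc t) =
      {p \<in> E_carrier l r. \<forall>q\<in>E_carrier l r. E_mult sU l r b u p q \<in> E.ann_series t}"
    unfolding E.ann_series_Suc_iff by (simp add: E_mult_commute[of _ p for p])
  also have "\<dots> = block {l - (Suc t - Suc r)<..l} (if Suc t \<le> r then {0} else UNIV) {r - Suc t<..r}"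
    (is "_ = ?S")
  proof (rule set_eqI)
    fix p :: "(nat \<Rightarrow> 'f) \<times> 'u \<times> (nat \<Rightarrow> 'f)"
    obtain \<alpha> x \<beta> where p: "p = (\<alpha>, x, \<beta>)"
      by (cases p)
    show "p \<in> {p \<in> E_carrier l r. \<forall>q\<in>E_carrier l r. E_mult sU l r b u p q \<in> E.ann_series t} \<longleftrightarrow>
        p \<in> ?S"
    proof (cases "p \<in> E_carrier l r")
      case False
      then show ?thesis
        by (auto simp: E_carrier_eq_block block_def p)
    next
      case True
      have supp: "\<alpha> i = 0" if "i \<notin> {1..l}" for i
        using True that by (auto simp: p E_carrier_def tuples_def)
      have supp': "\<beta> j = 0" if "j \<notin> {1..r}" for j
        using True that by (auto simp: p E_carrier_def tuples_def)
      \<comment> \<open>The places \<open>1, \<dots>, l - 1\<close> are seen through the left part of the product, and place \<open>l\<close>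
        through the middle part, because \<open>u\<close> is nonzero.\<close>
      have left: "(\<forall>i\<in>{2..l} - {l - (t - Suc r)<..l}. \<alpha> (i - 1) = 0) \<and> sU (\<alpha> l) u \<in> ?X \<longleftrightarrow>
          (\<forall>i. i \<notin> {l - (t - r)<..l} \<longrightarrow> \<alpha> i = 0)" (is "?L \<longleftrightarrow> ?R")
      proof
        assume L: ?L
        show ?R
        proof (intro allI impI)
          fix i assume i: "i \<notin> {l - (t - r)<..l}"
          show "\<alpha> i = 0"
          proof (cases "i \<in> {1..<l}")
            case True
            then have "Suc i \<in> {2..l} - {l - (t - Suc r)<..l}"
              using i by auto
            then show ?thesis
              using L[THEN conjunct1, rule_format, of "Suc i"] by simp
          next
            case False
            then show ?thesis
              using supp[of i] L i u_nonzero by (cases "i = l") (auto split: if_splits)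
          qed
        qed
      next
        assume R: ?R
        have "\<alpha> (i - 1) = 0" if "i \<in> {2..l} - {l - (t - Suc r)<..l}" for i
          using R that by auto
        moreover have "sU (\<alpha> l) u \<in> ?X"
          using R by auto
        ultimately show ?L
          by blast
      qed
      have right: "(\<forall>j\<in>{2..r} - {r - t<..r}. \<beta> (j - 1) = 0) \<longleftrightarrow>
          (\<forall>j. j \<notin> {r - Suc t<..r} \<longrightarrow> \<beta> j = 0)" (is "?L \<longleftrightarrow> ?R")
      proof
        assume L: ?L
        show ?R
        proof (intro allI impI)
          fix j assume j: "j \<notin> {r - Suc t<..r}"
          show "\<beta> j = 0"
          proof (cases "j \<in> {1..<r}")
            case True
            then have "Suc j \<in> {2..r} - {r - t<..r}"
              using j by auto
            then show ?thesis
              using L[rule_format, of "Suc j"] by simp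
          next
            case False
            then show ?thesis
              using supp'[of j] j r_pos by (cases "j = r") auto
          qed
        qed
      next
        assume R: ?R
        then show ?L
          by auto
      qed
      \<comment> \<open>As \<open>r \<ge> 1\<close>, the index \<open>1\<close>, where \<open>b(x, y)\<close> lands, is in \<open>{r - t<..r}\<close> iff \<open>r \<le> t\<close>.\<close>
      have mid: "(1 \<notin> {r - t<..r} \<longrightarrow> x = 0) \<longleftrightarrow> x \<in> (if Suc t \<le> r then {0} else UNIV)"
        using r_pos by auto
      have "(\<forall>q\<in>E_carrier l r. E_mult sU l r b u p q \<in> E.ann_series t) \<longleftrightarrow>
          (\<forall>i. i \<notin> {l - (t - r)<..l} \<longrightarrow> \<alpha> i = 0) \<and>
          x \<in> (if Suc t \<le> r then {0} else UNIV) \<and> (\<forall>j. j \<notin> {r - Suc t<..r} \<longrightarrow> \<beta> j = 0)"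
        unfolding p Suc mult_mem_block_iff[OF True[unfolded p] X] left[symmetric] right[symmetric]
          mid[symmetric] by blast
      also have "\<dots> \<longleftrightarrow> p \<in> ?S"
        by (simp only: p block_def mem_Collect_eq case_prod_conv diff_Suc_Suc)
      finally show ?thesis
        using True by blast
    qed
  qed
  finally show ?case .
qed

lemma ann_series_last: "E.ann_series (r + 1 + l) = E_carrier l r"
  unfolding ann_series_eq_block by (simp add: E_carrier_eq_block)

text \<open>Up to step \<open>r\<close> the middle component is missing, and \<open>u\<close> witnesses that it is not zero; after that
  the first left coordinate is the last one to be collected.\<close>

lemma ann_series_neq:
  assumes "t < r + 1 + l"
  shows "E.ann_series t \<noteq> E_carrier l r"
proof (cases "t \<le> r")
  case True
  have "middle u \<in> E_carrier l r" "middle u \<notin> E.ann_series t"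
    unfolding ann_series_eq_block using True u_nonzero
    by (auto simp: E_carrier_eq_block block_def middle_def)
  then show ?thesis
    by metis
next
  case False
  have "left_unit 1 \<in> E_carrier l r" "left_unit 1 \<notin> E.ann_series t"
    unfolding ann_series_eq_block using False assms l_pos
    by (auto simp: E_carrier_eq_block block_def unit_defs)
  then show ?thesis
    by metis
qed

lemma dim_ann_series:
  "E.dim (E.ann_series t) =
    min l (t - Suc r) + (if t \<le> r then 0 else dim UNIV) + min r t"
  unfolding ann_series_eq_block by (subst E_dim_block) (auto simp: subspace_single_0)

lemma E_finite_dimensional: "E.finite_dimensional"
proof -
  have "finite (block_basis {0<..l} BU {0<..r} :: ((nat \<Rightarrow> 'f) \<times> 'u \<times> (nat \<Rightarrow> 'f)) set)"
    using finite_Basis by (simp add: block_basis_def)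
  moreover have "E.span (block_basis {0<..l} BU {0<..r}) = E_carrier l r"
    by (simp add: E_span_block_basis span_Basis E_carrier_eq_block)
  ultimately show ?thesis
    unfolding E.finite_dimensional_def by blast
qed

lemma E_nilpotent: "E.nilpotent"
  by (rule E.nilpotent_if_ann_series_eq[OF ann_series_last])

lemma E_has_type: "E.has_type (replicate r 1 @ [dim UNIV] @ replicate l 1)"
proof -
  have "replicate r 1 @ [dim (UNIV :: 'u set)] @ replicate l 1 =
      map (\<lambda>i. E.dim (E.ann_series i) - E.dim (E.ann_series (i - 1))) [1..<Suc (r + 1 + l)]"
    by (rule nth_equalityI) (auto simp: nth_append dim_ann_series nth_Cons' simp del: upt_Suc)
  then show ?thesis
    unfolding E.has_type_def
    using E_finite_dimensional E_nilpotent ann_series_last ann_series_neq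
    by blast
qed

text \<open>Distinct basis vectors from different places multiply to zero, and so do unit vectors of different
  coordinates; within the middle place this is orthogonality with respect to \<open>b\<close>.\<close>

lemma ex_natural_basis:
  assumes "(2 :: 'f) \<noteq> 0"
  shows "\<exists>B. E.natural_basis B"
proof -
  obtain C where C: "independent C" "span C = UNIV"
    and orth: "\<And>x y. x \<in> C \<Longrightarrow> y \<in> C \<Longrightarrow> b x y \<noteq> 0 \<Longrightarrow> x = y"
    using ex_orthogonal_basis[OF assms bilinear symmetric subspace_UNIV] by metis
  let ?B = "block_basis {0<..l} C {0<..r} :: ((nat \<Rightarrow> 'f) \<times> 'u \<times> (nat \<Rightarrow> 'f)) set"
  have "E.independent ?B"
    by (rule E_independent_block_basis) fact
  moreover have "E.span ?B = E_carrier l r"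
    by (simp add: E_span_block_basis C(2) E_carrier_eq_block)
  moreover have "E_mult sU l r b u p q = 0" if "p \<in> ?B" "q \<in> ?B" "p \<noteq> q" for p q
    using that unfolding block_basis_def
    by (auto simp: unit_defs E_mult_Pair b_simps zero_prod_def fun_eq_iff intro: orth
        split: if_splits)
  ultimately show ?thesis
    unfolding E.natural_basis_def by blast
qed

lemma E_evolution_algebra:
  assumes "(2 :: 'f) \<noteq> 0"
  shows "evolution_algebra (E_scale sU) (E_carrier l r) (E_mult sU l r b u)"
  by unfold_locales (rule ex_natural_basis[OF assms])

end

theorem theorem2:
  fixes sU :: "'f::field \<Rightarrow> 'u::ab_group_add \<Rightarrow> 'u"
    and BU :: "'u set"
    and b :: "'u \<Rightarrow> 'u \<Rightarrow> 'f"
    and u :: 'u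
    and l r n :: nat
  assumes "CHAR('f) \<noteq> 2"
    and "l \<ge> 1" and "r \<ge> 1"
    and "finite_dimensional_vector_space sU BU"
    and "vector_space.dim sU (UNIV :: 'u set) = n"
    and "bilinear_form sU b" and "symmetric_form b" and "nondegenerate_form b"
    and "u \<noteq> 0"
  shows "evolution_algebra (E_scale sU) (E_carrier l r) (E_mult sU l r b u) \<and>
    nonassoc_algebra.nilpotent (E_scale sU) (E_carrier l r) (E_mult sU l r b u) \<and>
    nonassoc_algebra.has_type (E_scale sU) (E_carrier l r) (E_mult sU l r b u)
      (replicate r 1 @ [n] @ replicate l 1)"
proof -
  interpret U: finite_dimensional_vector_space sU BU
    by fact
  interpret E_lr_algebra sU BU b u l r
    using assms by unfold_locales
  show ?thesis
    using E_evolution_algebra[OF two_neq_zero_if_CHAR_neq_2[OF assms(1)]] E_nilpotent E_has_type assms(5)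
    by simp
qed

end
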